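(* Consider the inviscid Burgers' equation $\partial_t u+\partial_x\frac{u^2}{2}=0$ in one space dimension with periodic boundary conditions, and the SBP CPR semidiscretisation with $C=M^{-1}R^TB$ and correction terms for both divergence and restriction to the boundary, given on each element (in the standard element) by $$\partial_t\vec u+D\,\tfrac12\vec{u^2}+\tfrac13\Big(\underline{u}\,D\vec u-D\,\tfrac12\vec{u^2}\Big)+C\Big(\vec f^{num}-R\,\tfrac12\vec{u^2}-\tfrac13\big(\tfrac12(R\vec u)^2-\tfrac12R\,\vec{u^2}\big)\Big)=0.$$ If the numerical flux $f^{num}$ satisfies $$\tfrac16\big(u_-^3-u_+^3\big)-(u_--u_+)\,f^{num}(u_-,u_+)\le 0\qquad\text{for all }u_-,u_+\in\mathbb{R},$$ then this method is both conservative and stable in the discrete norm $\|\cdot\|_M$ induced by $M$. Moreover, the following numerical fluxes fulfil this condition: (a) the energy conservative (ECON) flux $f^{num}(u_-,u_+)=\frac14(u_+^2+u_-^2)-\frac{(u_+-u_-)^2}{12}$; (b) the local Lax–Friedrichs (LLF) flux $f^{num}(u_-,u_+)=\frac14(u_+^2+u_-^2)-\frac{\max(|u_+|,|u_-|)}{2}(u_+-u_-)$; (c) Osher's flux $$f^{num}(u_-,u_+)=\begin{cases}\frac{u_-^2}{2},&u_+,u_->0,\\ \frac{u_+^2}{2},&u_+,u_-<0,\\ \frac{u_+^2}{2}+\frac{u_-^2}{2},&u_-\ge 0\ge u_+,\\ 0,&u_-\le 0\le u_+.\end{cases}$$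
   Context: SBP basis. Let $z_0<\dots<z_p$ in $[-1,1]$ be distinct nodes (not necessarily including the endpoints) and $\omega_0,\dots,\omega_p>0$ quadrature weights. Let $\ell_j$ be the Lagrange polynomials of degree $\le p$ with $\ell_j(z_i)=\delta_{ij}$. A polynomial $u$ of degree $\le p$ is represented by $\vec u=(u(z_0),\dots,u(z_p))^T$. Put $M=\mathrm{diag}(\omega_0,\dots,\omega_p)$, $B=\mathrm{diag}(-1,1)$, $D_{ij}=\ell_j'(z_i)$, and let $R\in\mathbb{R}^{2\times(p+1)}$ have rows $(\ell_j(-1))_j$ and $(\ell_j(1))_j$, so $R\vec u=(u(-1),u(1))^T$. The SBP property $MD+D^TM=R^TBR$ is assumed. Notation. $\underline u=\mathrm{diag}(\vec u)$ is the multiplication matrix, $\vec{u^2}=\underline u\,\vec u$ is the componentwise square of $\vec u$, and $(R\vec u)^2\in\mathbb{R}^2$ is the componentwise square of $R\vec u$. $\|\vec u\|_M^2=\vec u^{\,T}M\vec u$ and $\vec 1=(1,\dots,1)^T$. Elements and interfaces. The spatial interval is divided into $N$ consecutive elements of widths $h_i>0$, with periodic boundary conditions (indices mod $N$). Each element is mapped affinely to $[-1,1]$; the displayed equation is to be read on element $i$ with $\vec u=\vec u^{\,i}$ and with $\partial_t\vec u$ multiplied by the Jacobian factor $h_i/2$. Further $\vec f^{num}=(f^{num}_{i-1/2},f^{num}_{i+1/2})^T$, where $f^{num}_{i+1/2}=f^{num}(u_-,u_+)$ is the common numerical flux at the interface between elements $i$ and $i+1$, $u_-$ being the second component of $R\vec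 u^{\,i}$ and $u_+$ the first component of $R\vec u^{\,i+1}$. Conservative means: for every solution, $\tfrac{h_i}{2}\frac{d}{dt}\vec 1^{\,T}M\vec u^{\,i}=-(f^{num}_{i+1/2}-f^{num}_{i-1/2})$ on each element; consequently $\sum_i\tfrac{h_i}{2}\vec 1^{\,T}M\vec u^{\,i}$ is constant in time. Stable in $\|\cdot\|_M$ means: every solution satisfies $\frac{d}{dt}\sum_i\tfrac{h_i}{2}\|\vec u^{\,i}\|_M^2\le 0$. *)

theory Defs
  imports "HOL-Analysis.Analysis" "HOL-Computational_Algebra.Polynomial"
begin

text \<open>
  The \<open>p + 1\<close> nodes are indexed by a finite linearly ordered type \<open>'n\<close>, so \<open>p + 1 = CARD('n)\<close>
  and \<open>z\<^sub>0 < \<dots> < z\<^sub>p\<close> is \<open>strict_mono z\<close>.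
\<close>

definition diag_mat :: "real ^ 'k \<Rightarrow> real ^ 'k ^ 'k" where
  "diag_mat v = (\<chi> i j. if i = j then v $ i else 0)"

definition lagrange_basis :: "('n::finite \<Rightarrow> real) \<Rightarrow> 'n \<Rightarrow> real poly" where
  "lagrange_basis z j = (\<Prod>k\<in>UNIV - {j}. smult (1 / (z j - z k)) [:- z k, 1:])"

lemma lagrange_basis_node:
  fixes z :: "'n::finite \<Rightarrow> real"
  assumes "inj z"
  shows "poly (lagrange_basis z j) (z i) = (if i = j then 1 else 0)"
proof (cases "i = j")
  case True
  have "poly (smult (1 / (z j - z k)) [:- z k, 1:]) (z j) = 1" if "k \<noteq> j" for k
  proof -
    have "z j - z k \<noteq> 0"
      using that assms by (auto dest: injD)
    then show ?thesis
      by (simp add: divide_simps)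
  qed
  then show ?thesis
    unfolding True lagrange_basis_def poly_prod by (auto intro!: prod.neutral)
next
  case False
  then show ?thesis
    by (auto simp: lagrange_basis_def poly_prod intro!: bexI[of _ i])
qed

lemma degree_lagrange_basis:
  fixes z :: "'n::finite \<Rightarrow> real"
  shows "degree (lagrange_basis z j) \<le> CARD('n) - 1"
proof -
  have "degree (lagrange_basis z j)
      \<le> (\<Sum>k\<in>UNIV - {j}. degree (smult (1 / (z j - z k)) [:- z k, 1:]))"
    unfolding lagrange_basis_def by (rule degree_prod_sum_le[unfolded o_def]) simp
  also have "\<dots> \<le> (\<Sum>k\<in>UNIV - {j}. 1)"
    by (rule sum_mono) (rule order_trans[OF degree_smult_le], simp)
  also have "\<dots> = CARD('n) - 1"
    by (simp add: card_Diff_singleton)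
  finally show ?thesis .
qed

definition mass_mat :: "('n::finite \<Rightarrow> real) \<Rightarrow> real ^ 'n ^ 'n" where
  "mass_mat \<omega> = diag_mat (\<chi> j. \<omega> j)"

definition deriv_mat :: "('n::finite \<Rightarrow> real) \<Rightarrow> real ^ 'n ^ 'n" where
  "deriv_mat z = (\<chi> i j. poly (pderiv (lagrange_basis z j)) (z i))"

definition restr_mat :: "('n::finite \<Rightarrow> real) \<Rightarrow> real ^ 'n ^ 2" where
  "restr_mat z = vector [\<chi> j. poly (lagrange_basis z j) (-1), \<chi> j. poly (lagrange_basis z j) 1]"

definition bdry_mat :: "real ^ 2 ^ 2" where
  "bdry_mat = diag_mat (vector [-1, 1])"

definition sbp_property :: "('n::finite \<Rightarrow> real) \<Rightarrow> ('n \<Rightarrow> real) \<Rightarrow> bool" where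
  "sbp_property z \<omega> \<longleftrightarrow>
     mass_mat \<omega> ** deriv_mat z + transpose (deriv_mat z) ** mass_mat \<omega>
       = transpose (restr_mat z) ** bdry_mat ** restr_mat z"

definition corr_mat :: "('n::finite \<Rightarrow> real) \<Rightarrow> ('n \<Rightarrow> real) \<Rightarrow> real ^ 2 ^ 'n" where
  "corr_mat z \<omega> = matrix_inv (mass_mat \<omega>) ** transpose (restr_mat z) ** bdry_mat"

definition vec_sq :: "real ^ 'k \<Rightarrow> real ^ 'k" where
  "vec_sq v = diag_mat v *v v"

definition norm_M_sq :: "('n::finite \<Rightarrow> real) \<Rightarrow> real ^ 'n \<Rightarrow> real" where
  "norm_M_sq \<omega> v = v \<bullet> (mass_mat \<omega> *v v)"

text \<open>
  The elements are \<open>0, \<dots>, N - 1\<close> with indices modulo \<open>N\<close>; \<open>U i\<close> is the nodal vector on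
  element \<open>i\<close>, and interface \<open>i\<close> is the one between the elements \<open>i\<close> and \<open>i + 1\<close>.
  A numerical flux \<open>f\<close> takes its arguments in the order \<open>u\<^sub>-\<close>, \<open>u\<^sub>+\<close>.
\<close>

definition interface_flux ::
  "('n::finite \<Rightarrow> real) \<Rightarrow> nat \<Rightarrow> (real \<Rightarrow> real \<Rightarrow> real) \<Rightarrow> (nat \<Rightarrow> real ^ 'n) \<Rightarrow> nat \<Rightarrow> real"
where
  "interface_flux z N f U i =
     f ((restr_mat z *v U i) $ 2) ((restr_mat z *v U ((i + 1) mod N)) $ 1)"

definition flux_left ::
  "('n::finite \<Rightarrow> real) \<Rightarrow> nat \<Rightarrow> (real \<Rightarrow> real \<Rightarrow> real) \<Rightarrow> (nat \<Rightarrow> real ^ 'n) \<Rightarrow> nat \<Rightarrow> real"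
where
  "flux_left z N f U i = interface_flux z N f U ((i + N - 1) mod N)"

definition flux_right ::
  "('n::finite \<Rightarrow> real) \<Rightarrow> nat \<Rightarrow> (real \<Rightarrow> real \<Rightarrow> real) \<Rightarrow> (nat \<Rightarrow> real ^ 'n) \<Rightarrow> nat \<Rightarrow> real"
where
  "flux_right z N f U i = interface_flux z N f U i"

definition num_flux_vec ::
  "('n::finite \<Rightarrow> real) \<Rightarrow> nat \<Rightarrow> (real \<Rightarrow> real \<Rightarrow> real) \<Rightarrow> (nat \<Rightarrow> real ^ 'n) \<Rightarrow> nat \<Rightarrow> real ^ 2"
where
  "num_flux_vec z N f U i = vector [flux_left z N f U i, flux_right z N f U i]"

definition burgers_spatial ::
  "('n::finite \<Rightarrow> real) \<Rightarrow> ('n \<Rightarrow> real) \<Rightarrow> real ^ 2 \<Rightarrow> real ^ 'n \<Rightarrow> real ^ 'n"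
where
  "burgers_spatial z \<omega> fnum u =
     (let D = deriv_mat z; R = restr_mat z; C = corr_mat z \<omega> in
        D *v ((1/2) *\<^sub>R vec_sq u)
        + (1/3) *\<^sub>R (diag_mat u *v (D *v u) - D *v ((1/2) *\<^sub>R vec_sq u))
        + C *v (fnum - R *v ((1/2) *\<^sub>R vec_sq u)
                - (1/3) *\<^sub>R ((1/2) *\<^sub>R vec_sq (R *v u) - (1/2) *\<^sub>R (R *v vec_sq u))))"

text \<open>
  Time intervals may be open or contain endpoints, where derivatives are one-sided.
\<close>

definition time_interval :: "real set \<Rightarrow> bool" where
  "time_interval T \<longleftrightarrow> is_interval T \<and> interior T \<noteq> {}"

definition burgers_solution ::
  "('n::finite \<Rightarrow> real) \<Rightarrow> ('n \<Rightarrow> real) \<Rightarrow> nat \<Rightarrow> (nat \<Rightarrow> real) \<Rightarrow> (real \<Rightarrow> real \<Rightarrow> real)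
     \<Rightarrow> real set \<Rightarrow> (nat \<Rightarrow> real \<Rightarrow> real ^ 'n) \<Rightarrow> bool"
where
  "burgers_solution z \<omega> N h f T u \<longleftrightarrow>
     (\<forall>i<N. \<forall>t\<in>T. \<exists>u'. (u i has_vector_derivative u') (at t within T) \<and>
        (h i / 2) *\<^sub>R u' + burgers_spatial z \<omega> (num_flux_vec z N f (\<lambda>j. u j t) i) (u i t) = 0)"

definition conservative ::
  "('n::finite \<Rightarrow> real) \<Rightarrow> ('n \<Rightarrow> real) \<Rightarrow> nat \<Rightarrow> (nat \<Rightarrow> real) \<Rightarrow> (real \<Rightarrow> real \<Rightarrow> real) \<Rightarrow> bool"
where
  "conservative z \<omega> N h f \<longleftrightarrow>
     (\<forall>T u. time_interval T \<longrightarrow> burgers_solution z \<omega> N h f T u \<longrightarrow>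
        (\<forall>i<N. \<forall>t\<in>T.
           ((\<lambda>s. h i / 2 * (vec 1 \<bullet> (mass_mat \<omega> *v u i s))) has_real_derivative
              - (flux_right z N f (\<lambda>j. u j t) i - flux_left z N f (\<lambda>j. u j t) i)) (at t within T)))"

definition stable_M ::
  "('n::finite \<Rightarrow> real) \<Rightarrow> ('n \<Rightarrow> real) \<Rightarrow> nat \<Rightarrow> (nat \<Rightarrow> real) \<Rightarrow> (real \<Rightarrow> real \<Rightarrow> real) \<Rightarrow> bool"
where
  "stable_M z \<omega> N h f \<longleftrightarrow>
     (\<forall>T u. time_interval T \<longrightarrow> burgers_solution z \<omega> N h f T u \<longrightarrow>
        (\<forall>t\<in>T. \<exists>E'. ((\<lambda>s. \<Sum>i<N. h i / 2 * norm_M_sq \<omega> (u i s)) has_real_derivative E')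
                         (at t within T) \<and> E' \<le> 0))"

lemma sum_flux_left:
  assumes "0 < N"
  shows "(\<Sum>i<N. flux_left z N f U i) = (\<Sum>i<N. flux_right z N f U i)"
proof -
  obtain m where m: "N = Suc m"
    using assms by (cases N) auto
  have "flux_left z N f U (Suc i) = flux_right z N f U i" if "i < m" for i
  proof -
    have "(Suc i + N - 1) mod N = (i + N) mod N"
      by simp
    also have "\<dots> = i"
      using that m by (simp only: mod_add_self2) simp
    finally show ?thesis
      by (simp only: flux_left_def flux_right_def)
  qed
  moreover have "flux_left z N f U 0 = flux_right z N f U m"
    by (simp add: flux_left_def flux_right_def m)
  ultimately have "flux_left z N f U 0 + (\<Sum>i<m. flux_left z N f U (Suc i))
      = flux_right z N f U m + (\<Sum>i<m. flux_right z N f U i)"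
    by simp
  moreover have "(\<Sum>i<N. flux_left z N f U i)
      = flux_left z N f U 0 + (\<Sum>i<m. flux_left z N f U (Suc i))"
    unfolding m by (rule sum.lessThan_Suc_shift)
  moreover have "(\<Sum>i<N. flux_right z N f U i)
      = flux_right z N f U m + (\<Sum>i<m. flux_right z N f U i)"
    by (simp add: m)
  ultimately show ?thesis
    by simp
qed

lemma conservative_imp_total_mass_constant:
  assumes "conservative z \<omega> N h f" "0 < N" "time_interval T" "burgers_solution z \<omega> N h f T u"
  shows "(\<lambda>t. \<Sum>i<N. h i / 2 * (vec 1 \<bullet> (mass_mat \<omega> *v u i t))) constant_on T"
proof -
  let ?m = "\<lambda>t. \<Sum>i<N. h i / 2 * (vec 1 \<bullet> (mass_mat \<omega> *v u i t))"
  have "(?m has_real_derivative 0) (at t within T)" if "t \<in> T" for t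
  proof -
    have "(?m has_real_derivative
        (\<Sum>i<N. - (flux_right z N f (\<lambda>j. u j t) i - flux_left z N f (\<lambda>j. u j t) i))) (at t within T)"
      using assms that unfolding conservative_def by (intro DERIV_sum) blast
    then show ?thesis
      using sum_flux_left[OF assms(2), of z f "\<lambda>j. u j t"] by (simp add: sum_subtractf sum_negf)
  qed
  moreover have "convex T"
    using assms(3) by (simp add: time_interval_def is_interval_convex)
  ultimately have "\<exists>c. \<forall>t\<in>T. ?m t = c"
    using has_field_derivative_zero_constant[of T ?m] by blast
  then show ?thesis
    by (simp add: constant_on_def)
qed

definition flux_condition :: "(real \<Rightarrow> real \<Rightarrow> real) \<Rightarrow> bool" where
  "flux_condition f \<longleftrightarrow> (\<forall>um up. (1/6) * (um ^ 3 - up ^ 3) - (um - up) * f um up \<le> 0)"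

definition econ_flux :: "real \<Rightarrow> real \<Rightarrow> real" where
  "econ_flux um up = (1/4) * (up\<^sup>2 + um\<^sup>2) - (up - um)\<^sup>2 / 12"

definition llf_flux :: "real \<Rightarrow> real \<Rightarrow> real" where
  "llf_flux um up = (1/4) * (up\<^sup>2 + um\<^sup>2) - max \<bar>up\<bar> \<bar>um\<bar> / 2 * (up - um)"

text \<open>
  The last two cases overlap only at \<open>um = up = 0\<close>, where both give \<open>0\<close>; together
  the four cases cover the plane, so the final branch is \<open>um \<le> 0 \<le> up\<close>.
\<close>

definition osher_flux :: "real \<Rightarrow> real \<Rightarrow> real" where
  "osher_flux um up =
     (if up > 0 \<and> um > 0 then um\<^sup>2 / 2
      else if up < 0 \<and> um < 0 then up\<^sup>2 / 2
      else if um \<ge> 0 \<and> 0 \<ge> up then up\<^sup>2 / 2 + um\<^sup>2 / 2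
      else 0)"

end

theory Submission
  imports Defs
begin

text \<open>
  Discrete integration by parts (the SBP property) turns every volume term, tested against a
  nodal vector, into boundary values. The factor \<open>1/3\<close> in the split form is chosen such
  that in the energy balance \<open>u\<^sup>T M D u\<^sup>2\<close> and \<open>u\<^sup>T M diag(u) D u\<close> combine to a pure boundary term,
  which the restriction correction reduces to \<open>u\<^sup>3/6\<close>. The energy that an element loses is
  \<open>(u\<^sub>R f\<^sub>R - u\<^sub>R\<^sup>3/6) - (u\<^sub>L f\<^sub>L - u\<^sub>L\<^sup>3/6)\<close>, and regrouping by interfaces yields exactly the
  expression in the flux condition.
\<close>

section \<open>Bilinear forms of the SBP matrices\<close>

lemma diag_mat_mult_vec: "diag_mat v *v x = (\<chi> i. v $ i * x $ i)"
  by (simp add: vec_eq_iff diag_mat_def matrix_vector_mult_def if_distrib[of "\<lambda>a. a * _"]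
      cong: if_cong)

lemma mass_mat_mult_vec: "mass_mat \<omega> *v x = (\<chi> j. \<omega> j * x $ j)"
  by (simp add: mass_mat_def diag_mat_mult_vec)

lemma inner_mass_mat_commute: "x \<bullet> (mass_mat \<omega> *v y) = y \<bullet> (mass_mat \<omega> *v x)"
  by (simp add: mass_mat_mult_vec inner_vec_def mult_ac)

lemma inner_mass_mat_diag:
  "x \<bullet> (mass_mat \<omega> *v (diag_mat u *v y)) = (diag_mat u *v x) \<bullet> (mass_mat \<omega> *v y)"
  by (simp add: mass_mat_mult_vec diag_mat_mult_vec inner_vec_def mult_ac)

lemma inner_bdry_mat: "x \<bullet> (bdry_mat *v y) = x $ 2 * y $ 2 - x $ 1 * y $ 1"
  by (simp add: bdry_mat_def diag_mat_mult_vec inner_vec_def sum_2)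

lemma invertible_mass_mat:
  assumes "\<And>j. \<omega> j \<noteq> 0"
  shows "invertible (mass_mat \<omega>)"
proof -
  have "mass_mat \<omega> ** mass_mat (\<lambda>j. 1 / \<omega> j) = mat 1"
    using assms
    by (simp add: matrix_eq matrix_vector_mul_assoc[symmetric] mass_mat_mult_vec)
  then show ?thesis
    using invertible_right_inverse by blast
qed

lemma invertible_matrix_inv_right:
  assumes "invertible A"
  shows "A ** matrix_inv A = mat 1"
  using someI_ex[OF assms[unfolded invertible_def]] by (simp add: matrix_inv_def)

lemma inner_transpose_mult_vec:
  fixes A :: "real ^ 'n ^ 'm"
  shows "x \<bullet> (transpose A *v y) = (A *v x) \<bullet> y"
  by (simp add: inner_commute[of x] inner_commute[of _ y] dot_lmul_matrix)

text \<open>The mass matrix cancels the inverse inside \<open>corr_mat\<close>, so a tested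
  correction term sees only the boundary values of the test vector.\<close>

lemma inner_mass_corr_mat:
  assumes "\<And>j. \<omega> j \<noteq> 0"
  shows "x \<bullet> (mass_mat \<omega> *v (corr_mat z \<omega> *v g)) = (restr_mat z *v x) \<bullet> (bdry_mat *v g)"
proof -
  have "mass_mat \<omega> ** corr_mat z \<omega> = transpose (restr_mat z) ** bdry_mat"
    using invertible_matrix_inv_right[OF invertible_mass_mat[of \<omega>, OF assms]]
    by (simp add: corr_mat_def matrix_mul_assoc)
  then show ?thesis
    by (metis inner_transpose_mult_vec matrix_vector_mul_assoc)
qed

text \<open>Discrete integration by parts: symmetry of the mass matrix brings the transposed term
  into the form with \<open>deriv_mat z *v x\<close>.\<close>

lemma sbp_inner:
  assumes "sbp_property z \<omega>"
  shows "x \<bullet> (mass_mat \<omega> *v (deriv_mat z *v y)) + y \<bullet> (mass_mat \<omega> *v (deriv_mat z *v x))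
       = (restr_mat z *v x) \<bullet> (bdry_mat *v (restr_mat z *v y))"
proof -
  have "x \<bullet> ((mass_mat \<omega> ** deriv_mat z + transpose (deriv_mat z) ** mass_mat \<omega>) *v y)
      = x \<bullet> ((transpose (restr_mat z) ** bdry_mat ** restr_mat z) *v y)"
    using assms by (simp add: sbp_property_def)
  then show ?thesis
    by (simp add: matrix_vector_mult_add_rdistrib inner_add_right inner_transpose_mult_vec
        inner_mass_mat_commute[of y] del: transpose_matrix_vector
        flip: matrix_vector_mul_assoc)
qed

section \<open>Exactness of the operators on constants\<close>

text \<open>Both sides have degree below the number of nodes and agree at every node.\<close>

lemma sum_lagrange_basis:
  fixes z :: "'n::finite \<Rightarrow> real"
  assumes "inj z"
  shows "(\<Sum>j\<in>UNIV. lagrange_basis z j) = 1"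
proof (rule poly_eqI_degree[of "range z"])
  have card: "card (range z) = CARD('n)"
    using assms by (rule card_image)
  show "card (range z) > degree (1 :: real poly)"
    by (simp add: card)
  have "degree (\<Sum>j\<in>UNIV. lagrange_basis z j) \<le> CARD('n) - 1"
    by (intro degree_sum_le degree_lagrange_basis) simp
  then show "card (range z) > degree (\<Sum>j\<in>UNIV. lagrange_basis z j)"
    unfolding card using zero_less_card_finite[where 'a='n] by linarith
next
  fix x assume "x \<in> range z"
  then show "poly (\<Sum>j\<in>UNIV. lagrange_basis z j) x = poly 1 x"
    using assms by (auto simp: poly_sum lagrange_basis_node)
qed

lemma deriv_mat_one:
  assumes "inj z"
  shows "deriv_mat z *v 1 = 0"
proof -
  have "(\<Sum>j\<in>UNIV. poly (pderiv (lagrange_basis z j)) x) = 0" for x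
    using arg_cong[OF sum_lagrange_basis[OF assms], of "\<lambda>p. poly (pderiv p) x"]
    by (simp add: higher_pderiv_sum[of 1, simplified] poly_sum)
  then show ?thesis
    by (simp add: vec_eq_iff deriv_mat_def matrix_vector_mult_def)
qed

lemma restr_mat_one:
  assumes "inj z"
  shows "restr_mat z *v 1 = 1"
proof -
  have "(\<Sum>j\<in>UNIV. poly (lagrange_basis z j) x) = 1" for x
    using arg_cong[OF sum_lagrange_basis[OF assms], of "\<lambda>p. poly p x"]
    by (simp add: poly_sum)
  then show ?thesis
    by (simp add: vec_eq_iff restr_mat_def matrix_vector_mult_def forall_2)
qed

section \<open>Mass and energy balance on one element\<close>

text \<open>The test vector stays free: \<open>w = 1\<close> gives the mass balance,
  \<open>w = u\<close> the energy balance. The terms in \<open>vec_sq u\<close> get weight 1/2 - 1/6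
  = 1/3 in the volume and -1/2 + 1/6 = -1/3 at the boundary.\<close>

lemma inner_mass_burgers_spatial:
  assumes "\<And>j. \<omega> j \<noteq> 0"
  shows "w \<bullet> (mass_mat \<omega> *v burgers_spatial z \<omega> g u)
    = (w \<bullet> (mass_mat \<omega> *v (deriv_mat z *v vec_sq u))
       + (diag_mat u *v w) \<bullet> (mass_mat \<omega> *v (deriv_mat z *v u))
       - (restr_mat z *v w) \<bullet> (bdry_mat *v (restr_mat z *v vec_sq u))) / 3
      + (restr_mat z *v w) \<bullet> (bdry_mat *v g)
      - (restr_mat z *v w) \<bullet> (bdry_mat *v vec_sq (restr_mat z *v u)) / 6"
  unfolding burgers_spatial_def Let_def
  by (simp add: matrix_vector_right_distrib matrix_vector_mult_diff_distrib
      matrix_vector_mult_scaleR inner_add_right inner_diff_right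
      inner_mass_mat_diag inner_mass_corr_mat[of \<omega>, OF assms] field_simps)

text \<open>Since \<open>deriv_mat z\<close> annihilates constants, the volume term in
  \<open>vec_sq u\<close> is a boundary term and cancels the restricted \<open>vec_sq u\<close>. The
  other volume term is half a boundary term, and 1/3 * 1/2 matches the weight 1/6 of the last
  correction.\<close>

lemma mass_burgers_spatial:
  assumes "inj z" "\<And>j. \<omega> j \<noteq> 0" "sbp_property z \<omega>"
  shows "1 \<bullet> (mass_mat \<omega> *v burgers_spatial z \<omega> g u) = g $ 2 - g $ 1"
proof -
  have "diag_mat u *v 1 = u"
    by (simp add: diag_mat_mult_vec vec_eq_iff)
  then show ?thesis
    using sbp_inner[OF assms(3), of 1 "vec_sq u"] sbp_inner[OF assms(3), of u u]
    by (simp add: inner_mass_burgers_spatial[of \<omega>, OF assms(2)] deriv_mat_one[OF assms(1)]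
        restr_mat_one[OF assms(1)] inner_bdry_mat vec_sq_def[of "restr_mat z *v u"]
        diag_mat_mult_vec)
qed

text \<open>As \<open>diag_mat u *v u\<close> is \<open>vec_sq u\<close>, the volume terms form the
  left side of \<open>sbp_inner\<close>, and their sum cancels the restricted
  \<open>vec_sq u\<close>. Only the flux and the cubes remain.\<close>

lemma energy_burgers_spatial:
  fixes u :: "real ^ 'n::finite"
  assumes "\<And>j. \<omega> j \<noteq> 0" "sbp_property z \<omega>"
  defines "r \<equiv> restr_mat z *v u"
  shows "u \<bullet> (mass_mat \<omega> *v burgers_spatial z \<omega> g u)
    = (r $ 2 * g $ 2 - r $ 2 ^ 3 / 6) - (r $ 1 * g $ 1 - r $ 1 ^ 3 / 6)"
proof -
  have "r \<bullet> (bdry_mat *v vec_sq r) = r $ 2 ^ 3 - r $ 1 ^ 3"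
    by (simp add: inner_bdry_mat vec_sq_def diag_mat_mult_vec power3_eq_cube)
  then show ?thesis
    using sbp_inner[OF assms(2), of u "vec_sq u"]
    by (simp add: inner_mass_burgers_spatial[of \<omega>, OF assms(1)] r_def vec_sq_def[of u]
        inner_bdry_mat[of _ g] algebra_simps)
qed

section \<open>Time derivatives of total mass and energy\<close>

lemma num_flux_vec_nth:
  "num_flux_vec z N f U i $ 1 = flux_left z N f U i"
  "num_flux_vec z N f U i $ 2 = flux_right z N f U i"
  by (simp_all add: num_flux_vec_def)

text \<open>The right neighbour of element \<open>i - 1\<close> is \<open>i\<close>, also across the
  periodic boundary; adding \<open>N\<close> first keeps the subtraction from truncating at
  \<open>i = 0\<close>.\<close>

lemma flux_left_eq:
  assumes "i < N"
  shows "flux_left z N f U i =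
    f ((restr_mat z *v U ((i + N - 1) mod N)) $ 2) ((restr_mat z *v U i) $ 1)"
proof -
  have "((i + N - 1) mod N + 1) mod N = (i + N - 1 + 1) mod N"
    by (rule mod_add_left_eq)
  also have "\<dots> = i"
    using assms by simp
  finally show ?thesis
    by (simp only: flux_left_def interface_flux_def)
qed

lemma burgers_solution_derivative:
  assumes "burgers_solution z \<omega> N h f T u" "i < N" "t \<in> T"
  obtains u' where "(u i has_vector_derivative u') (at t within T)"
    "\<And>w. h i / 2 * (w \<bullet> (mass_mat \<omega> *v u'))
      = - (w \<bullet> (mass_mat \<omega> *v burgers_spatial z \<omega> (num_flux_vec z N f (\<lambda>j. u j t) i) (u i t)))"
proof -
  obtain u' where u': "(u i has_vector_derivative u') (at t within T)"
    "(h i / 2) *\<^sub>R u' + burgers_spatial z \<omega> (num_flux_vec z N f (\<lambda>j. u j t) i) (u i t) = 0"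
    using assms unfolding burgers_solution_def by blast
  have "w \<bullet> (mass_mat \<omega> *v ((h i / 2) *\<^sub>R u')) =
     w \<bullet> (mass_mat \<omega> *v (- burgers_spatial z \<omega> (num_flux_vec z N f (\<lambda>j. u j t) i) (u i t)))" for w
    using u'(2) by (simp only: eq_neg_iff_add_eq_0[symmetric])
  then have "h i / 2 * (w \<bullet> (mass_mat \<omega> *v u'))
      = - (w \<bullet> (mass_mat \<omega> *v burgers_spatial z \<omega> (num_flux_vec z N f (\<lambda>j. u j t) i) (u i t)))" for w
    \<comment> \<open>With minuend 0 this pulls the minus sign out of the matrix product.\<close>
    using matrix_vector_mult_diff_distrib[of "mass_mat \<omega>" 0]
    by (simp add: matrix_vector_mult_scaleR)
  with u'(1) show ?thesis
    by (rule that)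
qed

lemma conservative_burgers:
  assumes "inj z" "\<And>j. \<omega> j \<noteq> 0" "sbp_property z \<omega>"
  shows "conservative z \<omega> N h f"
  unfolding conservative_def
proof (intro allI impI ballI)
  fix T u i t
  assume "burgers_solution z \<omega> N h f T u" "i < N" "t \<in> T"
  then obtain u' where u': "(u i has_vector_derivative u') (at t within T)"
    "\<And>w. h i / 2 * (w \<bullet> (mass_mat \<omega> *v u'))
      = - (w \<bullet> (mass_mat \<omega> *v burgers_spatial z \<omega> (num_flux_vec z N f (\<lambda>j. u j t) i) (u i t)))"
    by (rule burgers_solution_derivative) blast
  have "bounded_linear (\<lambda>x. h i / 2 * (vec 1 \<bullet> (mass_mat \<omega> *v x)))"
    by (intro bounded_linear_const_mult bounded_linear_compose[OF bounded_linear_inner_right]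
        matrix_vector_mul_bounded_linear)
  from bounded_linear.has_vector_derivative[OF this u'(1)]
  show "((\<lambda>s. h i / 2 * (vec 1 \<bullet> (mass_mat \<omega> *v u i s))) has_real_derivative
      - (flux_right z N f (\<lambda>j. u j t) i - flux_left z N f (\<lambda>j. u j t) i)) (at t within T)"
    by (simp add: u'(2)[of 1] mass_burgers_spatial[of z \<omega>, OF assms] num_flux_vec_nth
        has_real_derivative_iff_has_vector_derivative del: times_divide_eq_left)
qed

text \<open>The two terms of the product rule agree because the mass matrix is symmetric.\<close>

lemma has_real_derivative_norm_M_sq:
  assumes "(u has_vector_derivative u') (at t within T)"
  shows "((\<lambda>s. norm_M_sq \<omega> (u s)) has_real_derivative 2 * (u t \<bullet> (mass_mat \<omega> *v u')))
    (at t within T)"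
proof -
  have "((\<lambda>s. mass_mat \<omega> *v u s) has_vector_derivative mass_mat \<omega> *v u') (at t within T)"
    by (rule bounded_linear.has_vector_derivative[OF matrix_vector_mul_bounded_linear assms])
  note bounded_bilinear.has_vector_derivative[OF bounded_bilinear_inner assms this]
  moreover have "u' \<bullet> (mass_mat \<omega> *v u t) = u t \<bullet> (mass_mat \<omega> *v u')"
    by (rule inner_mass_mat_commute)
  ultimately show ?thesis
    by (simp add: norm_M_sq_def has_real_derivative_iff_has_vector_derivative)
qed

lemma stable_burgers:
  fixes z \<omega> :: "'n::finite \<Rightarrow> real"
  assumes "\<And>j. \<omega> j \<noteq> 0" "sbp_property z \<omega>" "0 < N" "flux_condition f"
  shows "stable_M z \<omega> N h f"
  unfolding stable_M_def
proof (intro allI impI ballI)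
  fix T and u :: "nat \<Rightarrow> real \<Rightarrow> real ^ 'n" and t
  assume sol: "burgers_solution z \<omega> N h f T u" and t: "t \<in> T"
  define U where "U j = u j t" for j
  define r where "r i = restr_mat z *v U i" for i
  \<comment> \<open>Treating the left boundary terms as a numerical flux \<open>g\<close> lets
    \<open>sum_flux_left\<close> shift them to the neighbouring element.\<close>
  define g where "g a b = b * f a b - b ^ 3 / 6" for a b
  define e where "e i = 2 * (flux_left z N g U i
    - (r i $ 2 * flux_right z N f U i - r i $ 2 ^ 3 / 6))" for i
  have "((\<lambda>s. h i / 2 * norm_M_sq \<omega> (u i s)) has_real_derivative e i) (at t within T)"
    if i: "i < N" for i
  proof -
    obtain u' where u': "(u i has_vector_derivative u') (at t within T)"
      "\<And>w. h i / 2 * (w \<bullet> (mass_mat \<omega> *v u'))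
        = - (w \<bullet> (mass_mat \<omega> *v burgers_spatial z \<omega> (num_flux_vec z N f U i) (U i)))"
      using burgers_solution_derivative[OF sol i t] unfolding U_def by blast
    have "h i / 2 * (2 * (u i t \<bullet> (mass_mat \<omega> *v u')))
        = 2 * (h i / 2 * (U i \<bullet> (mass_mat \<omega> *v u')))"
      by (simp add: U_def)
    also have "\<dots> = e i"
      unfolding u'(2) energy_burgers_spatial[of \<omega>, OF assms(1,2)] num_flux_vec_nth e_def
        flux_left_eq[OF i] g_def r_def
      by simp
    finally show ?thesis
      using DERIV_cmult[OF has_real_derivative_norm_M_sq[OF u'(1), of \<omega>], of "h i / 2"]
      by (simp only:)
  qed
  then have "((\<lambda>s. \<Sum>i<N. h i / 2 * norm_M_sq \<omega> (u i s)) has_real_derivative (\<Sum>i<N. e i))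
      (at t within T)"
    by (intro DERIV_sum) simp
  moreover have "(\<Sum>i<N. e i) \<le> 0"
  proof -
    have "(\<Sum>i<N. e i) = 2 * (\<Sum>i<N. flux_right z N g U i
        - (r i $ 2 * flux_right z N f U i - r i $ 2 ^ 3 / 6))"
      unfolding e_def sum_distrib_left[symmetric] sum_subtractf sum_flux_left[OF assms(3)] ..
    \<comment> \<open>Both terms now live at the same interface, and their difference is the left
      side of the flux condition.\<close>
    moreover have "flux_right z N g U i
        - (r i $ 2 * flux_right z N f U i - r i $ 2 ^ 3 / 6) \<le> 0" for i
      using assms(4)[unfolded flux_condition_def, rule_format, of "r i $ 2" "r ((i + 1) mod N) $ 1"]
      unfolding flux_right_def interface_flux_def g_def r_def by (simp add: algebra_simps)
    ultimately show ?thesis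
      by (simp add: sum_nonpos)
  qed
  ultimately show "\<exists>E'. ((\<lambda>s. \<Sum>i<N. h i / 2 * norm_M_sq \<omega> (u i s)) has_real_derivative E')
      (at t within T) \<and> E' \<le> 0"
    by blast
qed

section \<open>The three numerical fluxes\<close>

text \<open>The flux equals \<open>(um\<^sup>2 + um * up + up\<^sup>2) / 6\<close>, the cofactor of
  \<open>um - up\<close> in the cubic term, so equality holds.\<close>

lemma flux_condition_econ: "flux_condition econ_flux"
  unfolding flux_condition_def econ_flux_def
  by (simp add: field_simps power2_eq_square power3_eq_cube)

lemma flux_condition_llf: "flux_condition llf_flux"
  unfolding flux_condition_def
proof (intro allI)
  fix a b :: real
  define m where "m = max \<bar>b\<bar> \<bar>a\<bar>"
  have "- m \<le> a" "b \<le> m" "0 \<le> m"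
    by (auto simp: m_def)
  \<comment> \<open>From \<open>a - b \<ge> - 2 * m\<close> the sum is at least
    \<open>m / 3\<close>.\<close>
  then have "0 \<le> (a - b) / 12 + m / 2"
    by (simp add: field_simps)
  moreover have "(1/6) * (a ^ 3 - b ^ 3) - (a - b) * llf_flux a b
      = - ((a - b)\<^sup>2 * ((a - b) / 12 + m / 2))"
    unfolding llf_flux_def m_def[symmetric]
    by (simp add: field_simps power2_eq_square power3_eq_cube)
  ultimately show "(1/6) * (a ^ 3 - b ^ 3) - (a - b) * llf_flux a b \<le> 0"
    by simp
qed

lemma flux_condition_osher: "flux_condition osher_flux"
  unfolding flux_condition_def
proof (intro allI)
  fix a b :: real
  let ?F = "(1/6) * (a ^ 3 - b ^ 3) - (a - b) * osher_flux a b"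
  \<comment> \<open>The origin is left to the third case, so that the fourth always selects the last
    branch of \<open>osher_flux\<close>.\<close>
  consider "b > 0" "a > 0" | "b < 0" "a < 0" | "a \<ge> 0" "0 \<ge> b" | "a \<le> 0" "0 \<le> b" "a < 0 \<or> 0 < b"
    by linarith
  then show "?F \<le> 0"
  proof cases
    case 1
    \<comment> \<open>For equal signs the flux agrees with the cofactor of the cubic term at
      \<open>a = b\<close>, which yields a second factor \<open>a - b\<close>.\<close>
    then have "?F = - ((a - b)\<^sup>2 * (b + 2 * a) / 6)"
      by (simp add: osher_flux_def field_simps power2_eq_square power3_eq_cube)
    with 1 show ?thesis
      by simp
  next
    case 2
    then have "?F = (a - b)\<^sup>2 * (a + 2 * b) / 6"
      by (simp add: osher_flux_def field_simps power2_eq_square power3_eq_cube)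
    moreover have "(a - b)\<^sup>2 * (a + 2 * b) \<le> 0"
      using 2 by (intro mult_nonneg_nonpos) simp_all
    ultimately show ?thesis
      by linarith
  next
    case 3
    then have F: "?F = (a - b) * (a * b - 2 * (a\<^sup>2 + b\<^sup>2)) / 6"
      by (simp add: osher_flux_def field_simps power2_eq_square power3_eq_cube)
    have "a * b \<le> 0"
      using 3 by (intro mult_nonneg_nonpos)
    then have "a * b \<le> 2 * (a\<^sup>2 + b\<^sup>2)"
      by (rule order_trans) simp
    then have "(a - b) * (a * b - 2 * (a\<^sup>2 + b\<^sup>2)) \<le> 0"
      using 3 by (intro mult_nonneg_nonpos) simp_all
    with F show ?thesis
      by linarith
  next
    case 4
    \<comment> \<open>The flux vanishes here, and monotonicity of the cube decides the sign.\<close>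
    then have "?F = (a ^ 3 - b ^ 3) / 6"
      by (auto simp: osher_flux_def)
    moreover have "a ^ 3 \<le> b ^ 3"
      using 4 by (intro power_mono_odd) simp_all
    then have "(a ^ 3 - b ^ 3) / 6 \<le> 0"
      by simp
    ultimately show ?thesis
      by (simp only:)
  qed
qed

theorem theorem9:
  fixes z \<omega> :: "'n::{finite,linorder} \<Rightarrow> real" and N :: nat and h :: "nat \<Rightarrow> real"
  assumes nodes: "strict_mono z" "range z \<subseteq> {-1..1}"
    and weights: "\<And>j. 0 < \<omega> j"
    and sbp: "sbp_property z \<omega>"
    and elements: "0 < N" "\<And>i. i < N \<Longrightarrow> 0 < h i"
  shows "(\<forall>fnum. flux_condition fnum \<longrightarrow> conservative z \<omega> N h fnum \<and> stable_M z \<omega> N h fnum)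
       \<and> flux_condition econ_flux \<and> flux_condition llf_flux \<and> flux_condition osher_flux"
proof -
  have "inj z"
    using nodes(1) by (rule strict_mono_imp_inj_on)
  moreover have "\<omega> j \<noteq> 0" for j
    using weights[of j] by simp
  ultimately show ?thesis
    using sbp elements(1) conservative_burgers stable_burgers
      flux_condition_econ flux_condition_llf flux_condition_osher
    by blast
qed

end
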